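(* Let $F_{[\boldsymbol{X}]}\colon\mathbb{R}^{2p}\to[0,1]$ be the containment distribution function of a random $p$-hyper-rectangle $[\boldsymbol{X}]$. If $F_{[\boldsymbol{X}]}$ is $2p$-times differentiable, then the density function of $[\boldsymbol{X}]$ is $$f_{[\boldsymbol{X}]}(\underline{x}_1,\overline{x}_1,\ldots,\underline{x}_p,\overline{x}_p)=(-1)^p\frac{\partial^{2p}}{\partial\underline{x}_1\partial\overline{x}_1\cdots\partial\underline{x}_p\partial\overline{x}_p}F_{[\boldsymbol{X}]}(\underline{x}_1,\overline{x}_1,\ldots,\underline{x}_p,\overline{x}_p).$$
   Context: $\mathbb{I}=\{[x,y]\colon -\infty<x\le y<+\infty\}$ is the set of closed bounded intervals. A $p$-hyper-rectangle is a $p$-tuple $[\boldsymbol{x}]=([x_1],\ldots,[x_p])\in\mathbb{I}^p$ with $[x_j]=[\underline{x}_j,\overline{x}_j]$; $[\boldsymbol{x}']\subseteq[\boldsymbol{x}]$ means $[x_j']\subseteq[x_j]$ for every $j$. A random $p$-hyper-rectangle $[\boldsymbol{X}]=([X_1],\ldots,[X_p])$ is a $p$-tuple of random intervals, $[X_j]=[\underline{X}_j,\overline{X}_j]$, $\underline{X}_j\le\overline{X}_j$. Its density function $f_{[\boldsymbol{X}]}$ is the joint density of $(\underline{X}_1,\overline{X}_1,\ldots,\underline{X}_p,\overline{X}_p)$ with respect to Lebesgue measure on $\mathbb{R}^{2p}$. Its containment distribution function $F_{[\boldsymbol{X}]}\colon\mathbb{R}^{2p}\to[0,1]$ is $F_{[\boldsymbol{X}]}(\underline{x}_1,\overline{x}_1,\ldots,\underline{x}_p,\overline{x}_p)=P([\boldsymbol{X}]\subseteq[\boldsymbol{x}])$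 when $\underline{x}_j\le\overline{x}_j$ for all $j$, and $0$ otherwise. Differentiability is meant for $F_{[\boldsymbol{X}]}$ as a function on all of $\mathbb{R}^{2p}$. The claim includes that the law of $[\boldsymbol{X}]$ has such a density. *)

theory Defs
  imports "HOL-Probability.Probability"
begin

text \<open>
  A point \<open>x :: (real \<times> real) ^ 'p\<close> is the coordinate tuple \<open>(l\<^sub>1, u\<^sub>1, \<dots>, l\<^sub>p, u\<^sub>p)\<close> of \<open>\<real>\<^sup>2\<^sup>p\<close>,
  with \<open>p = CARD('p)\<close> and \<open>x $ j = (l\<^sub>j, u\<^sub>j)\<close>; a hyper-rectangle is represented by its tuple of
  endpoints. The order \<open>l\<^sub>j \<le> u\<^sub>j\<close> is not built into the type, since the containment distribution
  function lives on all of \<open>\<real>\<^sup>2\<^sup>p\<close>.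
\<close>

type_synonym 'p endpoints = "(real \<times> real, 'p) vec"

definition lower :: "'p::finite endpoints \<Rightarrow> 'p \<Rightarrow> real" where
  "lower x j = fst (x $ j)"

definition upper :: "'p::finite endpoints \<Rightarrow> 'p \<Rightarrow> real" where
  "upper x j = snd (x $ j)"

definition hyper_rectangle :: "'p::finite endpoints \<Rightarrow> bool" where
  "hyper_rectangle x \<longleftrightarrow> (\<forall>j. lower x j \<le> upper x j)"

definition contained :: "'p::finite endpoints \<Rightarrow> 'p endpoints \<Rightarrow> bool" where
  "contained x' x \<longleftrightarrow> (\<forall>j. {lower x' j..upper x' j} \<subseteq> {lower x j..upper x j})"

definition random_hyper_rectangle :: "'a measure \<Rightarrow> ('a \<Rightarrow> 'p::finite endpoints) \<Rightarrow> bool" where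
  "random_hyper_rectangle M X \<longleftrightarrow>
     prob_space M \<and> X \<in> borel_measurable M \<and> (\<forall>\<omega>\<in>space M. hyper_rectangle (X \<omega>))"

definition containment_cdf ::
    "'a measure \<Rightarrow> ('a \<Rightarrow> 'p::finite endpoints) \<Rightarrow> 'p endpoints \<Rightarrow> real" where
  "containment_cdf M X x =
     (if hyper_rectangle x then measure M {\<omega> \<in> space M. contained (X \<omega>) x} else 0)"

text \<open>Nonnegativity is required separately because \<^const>\<open>ennreal\<close> maps negative reals to 0.\<close>

definition has_density_function ::
    "'a measure \<Rightarrow> ('a \<Rightarrow> 'p::finite endpoints) \<Rightarrow> ('p endpoints \<Rightarrow> real) \<Rightarrow> bool" where
  "has_density_function M X f \<longleftrightarrow>
     (\<forall>x. 0 \<le> f x) \<and> distributed M lborel X (\<lambda>x. ennreal (f x))"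

text \<open>
  \<open>k\<close>-fold (Frechet) differentiability on the whole space, without continuity of the last
  derivative. The type of the \<open>k\<close>-th derivative depends on \<open>k\<close>, so the recursion asks for
  \<open>k\<close>-fold differentiability of \<open>x \<mapsto> Df(x) v\<close> for every fixed \<open>v\<close>; on a finite-dimensional
  domain this is the same as \<open>k\<close>-fold differentiability of \<open>x \<mapsto> Df(x)\<close>.
\<close>

primrec times_differentiable ::
    "nat \<Rightarrow> ('a::euclidean_space \<Rightarrow> 'b::real_normed_vector) \<Rightarrow> bool" where
  "times_differentiable 0 f \<longleftrightarrow> True"
| "times_differentiable (Suc k) f \<longleftrightarrow>
     (\<forall>x. f differentiable (at x)) \<and>
     (\<forall>v. times_differentiable k (\<lambda>x. frechet_derivative f (at x) v))"

definition partial_lower ::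
    "'p::finite \<Rightarrow> ('p endpoints \<Rightarrow> real) \<Rightarrow> 'p endpoints \<Rightarrow> real" where
  "partial_lower j f x = deriv (\<lambda>t. f (x + t *\<^sub>R axis j (1, 0))) 0"

definition partial_upper ::
    "'p::finite \<Rightarrow> ('p endpoints \<Rightarrow> real) \<Rightarrow> 'p endpoints \<Rightarrow> real" where
  "partial_upper j f x = deriv (\<lambda>t. f (x + t *\<^sub>R axis j (0, 1))) 0"

text \<open>
  For \<open>js = [j\<^sub>1, \<dots>, j\<^sub>p]\<close> this is \<open>\<partial>\<^sup>2\<^sup>p / \<partial>l\<^sub>1 \<partial>u\<^sub>1 \<dots> \<partial>l\<^sub>p \<partial>u\<^sub>p\<close>, the rightmost partial derivative
  being taken first.
\<close>

definition mixed_partial ::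
    "'p::finite list \<Rightarrow> ('p endpoints \<Rightarrow> real) \<Rightarrow> 'p endpoints \<Rightarrow> real" where
  "mixed_partial js f = foldr (\<lambda>j g. partial_lower j (partial_upper j g)) js f"

end

theory Submission
  imports Defs
begin

text \<open>
  Since \<open>X\<close> is a genuine hyper-rectangle, \<open>F(x) = P(\<forall>j. l\<^sub>j \<le> L\<^sub>j \<and> U\<^sub>j \<le> u\<^sub>j)\<close> holds on all of
  \<open>\<real>\<^sup>2\<^sup>p\<close>, so \<open>F\<close> is a distribution function with the orientation of \<open>p\<close> axes reversed, and the
  iterated differences of \<open>G = (-1)\<^sup>p F\<close> are the probabilities of half-open boxes. The iterated
  partial derivative \<open>g\<close> of \<open>G\<close> is an iterated limit of difference quotients, hence nonnegative
  and Borel. It need not be continuous, but the fundamental theorem of calculus holds for every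
  nonnegative Borel derivative; by Tonelli, integrating out one coordinate at a time replaces one
  derivative by one difference. So the integral of \<open>g\<close> over a box is the iterated difference
  of \<open>G\<close>, and the law of \<open>X\<close> agrees with \<open>g dx\<close> on boxes.
\<close>

section \<open>Iterated directional derivatives and iterated differences\<close>

definition dir_deriv :: "'e::real_normed_vector \<Rightarrow> ('e \<Rightarrow> real) \<Rightarrow> 'e \<Rightarrow> real" where
  "dir_deriv b g x = deriv (\<lambda>t. g (x + t *\<^sub>R b)) 0"

definition iter_deriv :: "'e::real_normed_vector list \<Rightarrow> ('e \<Rightarrow> real) \<Rightarrow> 'e \<Rightarrow> real" where
  "iter_deriv bs g = foldr dir_deriv bs g"

definition diff_step :: "'e::real_normed_vector \<Rightarrow> real \<Rightarrow> ('e \<Rightarrow> real) \<Rightarrow> 'e \<Rightarrow> real" where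
  "diff_step b s g x = g (x + s *\<^sub>R b) - g x"

text \<open>The step length is a function of the direction. The head direction acts on
  \<open>g\<close> first here, but last in \<open>iter_deriv\<close>: an induction on the list can
  then trade the outermost derivative for a difference inside the remaining ones.\<close>

primrec iter_diff ::
    "'e::real_normed_vector list \<Rightarrow> ('e \<Rightarrow> real) \<Rightarrow> ('e \<Rightarrow> real) \<Rightarrow> 'e \<Rightarrow> real" where
  "iter_diff [] h g = g"
| "iter_diff (b # bs) h g = iter_diff bs h (diff_step b (h b) g)"

text \<open>Existence of each derivative has to be demanded, since \<open>deriv\<close> is an
  unspecified value where there is none.\<close>

primrec iter_differentiable :: "'e::real_normed_vector list \<Rightarrow> ('e \<Rightarrow> real) \<Rightarrow> bool" where
  "iter_differentiable [] g \<longleftrightarrow> True"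
| "iter_differentiable (b # bs) g \<longleftrightarrow> iter_differentiable bs g \<and>
     (\<forall>x. DERIV (\<lambda>t. iter_deriv bs g (x + t *\<^sub>R b)) 0 :> iter_deriv (b # bs) g x)"

lemma iter_deriv_Nil [simp]: "iter_deriv [] g = g"
  by (simp add: iter_deriv_def)

lemma iter_deriv_Cons: "iter_deriv (b # bs) g = dir_deriv b (iter_deriv bs g)"
  by (simp add: iter_deriv_def)

lemma iter_differentiable_DERIV:
  assumes "iter_differentiable (b # bs) g"
  shows "DERIV (\<lambda>t. iter_deriv bs g (x + t *\<^sub>R b)) s :> iter_deriv (b # bs) g (x + s *\<^sub>R b)"
proof -
  have "DERIV (\<lambda>t. iter_deriv bs g ((x + s *\<^sub>R b) + t *\<^sub>R b)) 0 :> iter_deriv (b # bs) g (x + s *\<^sub>R b)"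
    using assms by simp
  then show ?thesis
    using DERIV_shift[of "\<lambda>t. iter_deriv bs g (x + t *\<^sub>R b)" _ 0 s]
    by (simp add: algebra_simps)
qed

text \<open>A difference is a translate minus the function itself, and directional derivatives are
  linear and commute with translations.\<close>

lemma
  assumes "iter_differentiable bs g"
  shows iter_differentiable_diff_step: "iter_differentiable bs (diff_step b s g)"
    and iter_deriv_diff_step: "iter_deriv bs (diff_step b s g) = diff_step b s (iter_deriv bs g)"
proof -
  have "iter_differentiable bs (diff_step b s g) \<and>
      iter_deriv bs (diff_step b s g) = diff_step b s (iter_deriv bs g)"
    using assms
  proof (induction bs)
    case (Cons c bs)
    have "DERIV (\<lambda>t. iter_deriv bs g (x + s *\<^sub>R b + t *\<^sub>R c) - iter_deriv bs g (x + t *\<^sub>R c)) 0 :>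
        diff_step b s (iter_deriv (c # bs) g) x" for x
      unfolding diff_step_def using Cons.prems by (intro DERIV_diff) auto
    then have D: "DERIV (\<lambda>t. iter_deriv bs (diff_step b s g) (x + t *\<^sub>R c)) 0 :>
        diff_step b s (iter_deriv (c # bs) g) x" for x
      using Cons by (simp add: diff_step_def[abs_def] algebra_simps)
    have "iter_deriv (c # bs) (diff_step b s g) = diff_step b s (iter_deriv (c # bs) g)"
      unfolding iter_deriv_Cons[of _ _ "diff_step b s g"]
      by (rule ext) (simp add: dir_deriv_def DERIV_imp_deriv[OF D])
    with D Cons show ?case
      by simp
  qed simp
  then show "iter_differentiable bs (diff_step b s g)"
    "iter_deriv bs (diff_step b s g) = diff_step b s (iter_deriv bs g)"
    by auto
qed

lemma iter_diff_cong:
  "(\<And>b. b \<in> set bs \<Longrightarrow> h b = h' b) \<Longrightarrow> iter_diff bs h g = iter_diff bs h' g"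
  by (induction bs arbitrary: g) auto

text \<open>Lets a hypothesis on \<open>g\<close> for all step functions be used for
  \<open>diff_step b s g\<close>: the step at \<open>b\<close> can be prescribed freely, because
  \<open>b\<close> does not recur in \<open>bs\<close>.\<close>

lemma iter_diff_Cons_upd:
  "b \<notin> set bs \<Longrightarrow> iter_diff (b # bs) (h(b := s)) g = iter_diff bs h (diff_step b s g)"
  by (simp, rule iter_diff_cong) auto

text \<open>The numerator of a difference quotient along the head is \<open>iter_deriv bs\<close> of
  a difference of \<open>g\<close>. Iterated differences of that difference are again iterated
  differences of \<open>g\<close>, so induction applies before passing to the limit.\<close>

lemma iter_deriv_nonneg:
  assumes "iter_differentiable bs g" "distinct bs"
    and "\<And>h x. (\<And>b. 0 \<le> h b) \<Longrightarrow> 0 \<le> iter_diff bs h g x"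
  shows "0 \<le> iter_deriv bs g x"
  using assms
proof (induction bs arbitrary: g x)
  case (Cons b bs)
  have step: "0 \<le> iter_deriv bs (diff_step b t g) x" if "0 < t" for t
  proof (rule Cons.IH)
    fix h :: "'a \<Rightarrow> real" and x
    assume "\<And>b. 0 \<le> h b"
    then show "0 \<le> iter_diff bs h (diff_step b t g) x"
      using Cons.prems(3)[of "h(b := t)" x] that Cons.prems(2) iter_diff_Cons_upd[of b bs h t g]
      by fastforce
  qed (use Cons.prems iter_differentiable_diff_step in auto)
  \<comment> \<open>The sign of differences is known for nonnegative steps, so the derivative is
    read as a limit from the right.\<close>
  have "((\<lambda>t. (iter_deriv bs g (x + t *\<^sub>R b) - iter_deriv bs g x) / t) \<longlongrightarrow>
      iter_deriv (b # bs) g x) (at_right 0)"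
    using Cons.prems(1) by (auto simp: DERIV_def intro: tendsto_within_subset)
  moreover have "\<forall>\<^sub>F t in at_right 0. 0 \<le> (iter_deriv bs g (x + t *\<^sub>R b) - iter_deriv bs g x) / t"
    using step Cons.prems(1)
    by (auto simp: iter_deriv_diff_step diff_step_def eventually_at_filter)
  ultimately show ?case
    by (intro tendsto_lowerbound) auto
qed (simp, force)

text \<open>By induction the difference quotients with step \<open>1 / (n + 1)\<close> are Borel,
  and they converge pointwise to the derivative.\<close>

lemma borel_measurable_iter_deriv:
  fixes bs :: "'e::euclidean_space list"
  assumes "iter_differentiable bs g" "g \<in> borel_measurable borel"
  shows "iter_deriv bs g \<in> borel_measurable borel"
  using assms
proof (induction bs)
  case (Cons b bs)
  then have [measurable]: "iter_deriv bs g \<in> borel_measurable borel"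
    by simp
  show ?case
  proof (rule borel_measurable_LIMSEQ_real)
    fix x
    have "((\<lambda>t. (iter_deriv bs g (x + t *\<^sub>R b) - iter_deriv bs g x) / t) \<longlongrightarrow>
        iter_deriv (b # bs) g x) (at 0)"
      using Cons.prems by (auto simp: DERIV_def)
    moreover have "filterlim (\<lambda>n. inverse (real (Suc n))) (at 0) sequentially"
      unfolding filterlim_at using LIMSEQ_inverse_real_of_nat by auto
    ultimately show "(\<lambda>n. (iter_deriv bs g (x + inverse (real (Suc n)) *\<^sub>R b) - iter_deriv bs g x)
        / inverse (real (Suc n))) \<longlonglongrightarrow> iter_deriv (b # bs) g x"
      by (rule filterlim_compose)
  qed measurable
qed simp

lemma iter_deriv_cmult:
  assumes "iter_differentiable bs g"
  shows "iter_differentiable bs (\<lambda>x. c * g x)"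
    and "iter_deriv bs (\<lambda>x. c * g x) = (\<lambda>x. c * iter_deriv bs g x)"
proof -
  have "iter_differentiable bs (\<lambda>x. c * g x) \<and>
      iter_deriv bs (\<lambda>x. c * g x) = (\<lambda>x. c * iter_deriv bs g x)"
    using assms
  proof (induction bs)
    case (Cons b bs)
    have D: "DERIV (\<lambda>t. iter_deriv bs (\<lambda>x. c * g x) (x + t *\<^sub>R b)) 0 :>
        c * iter_deriv (b # bs) g x" for x
      using Cons by (auto intro!: DERIV_cmult)
    have "iter_deriv (b # bs) (\<lambda>x. c * g x) = (\<lambda>x. c * iter_deriv (b # bs) g x)"
      unfolding iter_deriv_Cons[of _ _ "\<lambda>x. c * g x"]
      by (rule ext) (simp add: dir_deriv_def DERIV_imp_deriv[OF D])
    with D Cons show ?case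
      by simp
  qed simp
  then show "iter_differentiable bs (\<lambda>x. c * g x)"
    "iter_deriv bs (\<lambda>x. c * g x) = (\<lambda>x. c * iter_deriv bs g x)"
    by auto
qed

section \<open>Integrals of iterated derivatives over boxes\<close>

text \<open>The integration variable \<open>f\<close> holds the coefficients along
  \<open>bs\<close>. Tonelli isolates the head coefficient; integrating it turns the outermost
  derivative into a difference, which moves inside the others. The base point \<open>x\<close> is
  arbitrary so that it can absorb the left endpoint of the head interval.\<close>

lemma nn_integral_iter_deriv_PiM:
  fixes bs :: "'e::euclidean_space list"
  assumes "iter_differentiable bs g" "distinct bs" "g \<in> borel_measurable borel"
    and "\<And>h x. (\<And>b. 0 \<le> h b) \<Longrightarrow> 0 \<le> iter_diff bs h g x"
    and ac: "\<And>b. b \<in> set bs \<Longrightarrow> a b \<le> c b"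
  shows "(\<integral>\<^sup>+f. ennreal (iter_deriv bs g (x + (\<Sum>b\<in>set bs. f b *\<^sub>R b))) *
        (\<Prod>b\<in>set bs. indicator {a b..c b} (f b)) \<partial>Pi\<^sub>M (set bs) (\<lambda>_. lborel)) =
    ennreal (iter_diff bs (\<lambda>b. c b - a b) g (x + (\<Sum>b\<in>set bs. a b *\<^sub>R b)))"
  using assms
proof (induction bs arbitrary: g x)
  case Nil
  show ?case
    by (simp add: PiM_empty nn_integral_count_space_finite)
next
  case (Cons b bs)
  interpret product_sigma_finite "\<lambda>_::'e. lborel :: real measure" by standard
  have b: "b \<notin> set bs" and ab: "a b \<le> c b"
    using Cons.prems by auto
  have [measurable]: "iter_deriv (b # bs) g \<in> borel_measurable borel"
    using Cons.prems by (intro borel_measurable_iter_deriv) auto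
  have nonneg: "0 \<le> iter_deriv (b # bs) g y" for y
    using Cons.prems by (intro iter_deriv_nonneg) auto
  define s where "s = c b - a b"
  have upd: "(\<Sum>d\<in>set (b # bs). (f(b := y)) d *\<^sub>R d) = (\<Sum>d\<in>set bs. f d *\<^sub>R d) + y *\<^sub>R b"
    "(\<Prod>d\<in>set (b # bs). indicator {a d..c d} ((f(b := y)) d)) =
      (\<Prod>d\<in>set bs. indicator {a d..c d} (f d)) * (indicator {a b..c b} y :: ennreal)"
    for f :: "'e \<Rightarrow> real" and y
    using b by (auto simp: mult.commute add.commute intro!: sum.cong prod.cong arg_cong2[where f="(*)"]
        arg_cong2[where f="(+)"])
  \<comment> \<open>The other coefficients are frozen in \<open>z\<close>. Along the line in
    direction \<open>b\<close> the integrand is a nonnegative Borel derivative of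
    \<open>iter_deriv bs g\<close>, and the difference of the endpoint values commutes with
    \<open>iter_deriv bs\<close>.\<close>
  have FTC: "(\<integral>\<^sup>+y. ennreal (iter_deriv (b # bs) g (z + y *\<^sub>R b)) * indicator {a b..c b} y \<partial>lborel)
      = ennreal (iter_deriv bs (diff_step b s g) (z + a b *\<^sub>R b))" for z
  proof -
    have "(\<integral>\<^sup>+y. ennreal (iter_deriv (b # bs) g (z + y *\<^sub>R b)) * indicator {a b..c b} y \<partial>lborel)
      = ennreal (iter_deriv bs g (z + c b *\<^sub>R b) - iter_deriv bs g (z + a b *\<^sub>R b))"
      using ab nonneg iter_differentiable_DERIV[OF Cons.prems(1)] by (intro nn_integral_FTC_Icc) auto
    also have "\<dots> = ennreal (iter_deriv bs (diff_step b s g) (z + a b *\<^sub>R b))"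
      using Cons.prems(1) by (simp add: iter_deriv_diff_step diff_step_def s_def algebra_simps)
    finally show ?thesis .
  qed
  have "(\<integral>\<^sup>+f. ennreal (iter_deriv (b # bs) g (x + (\<Sum>d\<in>set (b # bs). f d *\<^sub>R d))) *
        (\<Prod>d\<in>set (b # bs). indicator {a d..c d} (f d)) \<partial>Pi\<^sub>M (set (b # bs)) (\<lambda>_. lborel)) =
      (\<integral>\<^sup>+f. \<integral>\<^sup>+y. ennreal (iter_deriv (b # bs) g (x + (\<Sum>d\<in>set (b # bs). (f(b := y)) d *\<^sub>R d))) *
        (\<Prod>d\<in>set (b # bs). indicator {a d..c d} ((f(b := y)) d)) \<partial>lborel \<partial>Pi\<^sub>M (set bs) (\<lambda>_. lborel))"
    unfolding list.set(2) using b by (intro product_nn_integral_insert) (simp, simp, measurable)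
  also have "\<dots> = (\<integral>\<^sup>+f. (\<Prod>d\<in>set bs. indicator {a d..c d} (f d)) *
      (\<integral>\<^sup>+y. ennreal (iter_deriv (b # bs) g ((x + (\<Sum>d\<in>set bs. f d *\<^sub>R d)) + y *\<^sub>R b)) *
        indicator {a b..c b} y \<partial>lborel) \<partial>Pi\<^sub>M (set bs) (\<lambda>_. lborel))"
    unfolding upd by (subst nn_integral_cmult[symmetric]) (simp_all add: ac_simps)
  also have "\<dots> = (\<integral>\<^sup>+f. ennreal (iter_deriv bs (diff_step b s g)
        ((x + a b *\<^sub>R b) + (\<Sum>d\<in>set bs. f d *\<^sub>R d))) *
        (\<Prod>d\<in>set bs. indicator {a d..c d} (f d)) \<partial>Pi\<^sub>M (set bs) (\<lambda>_. lborel))"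
    unfolding FTC by (simp add: ac_simps)
  also have "\<dots> = ennreal (iter_diff bs (\<lambda>d. c d - a d) (diff_step b s g)
      ((x + a b *\<^sub>R b) + (\<Sum>d\<in>set bs. a d *\<^sub>R d)))"
  proof (rule Cons.IH)
    have [measurable]: "g \<in> borel_measurable borel"
      by fact
    show "diff_step b s g \<in> borel_measurable borel"
      unfolding diff_step_def[abs_def] by measurable
    \<comment> \<open>The prescribed step \<open>s\<close> is nonnegative because
      \<open>a b \<le> c b\<close>.\<close>
    show "0 \<le> iter_diff bs h (diff_step b s g) y" if "\<And>b. 0 \<le> h b" for h y
      using Cons.prems(4)[of "h(b := s)" y] that ab b iter_diff_Cons_upd[of b bs h s g]
      by (fastforce simp: s_def)
  qed (use Cons.prems iter_differentiable_diff_step in auto)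
  finally show ?case
    using b by (simp add: s_def ac_simps)
qed

text \<open>\<open>lborel\<close> is the image of the product measure under the expansion in
  \<open>Basis\<close>, which turns the indicator of a box into a product of interval indicators.
  The integral over coefficients then applies with base point 0.\<close>

lemma emeasure_density_iter_deriv_cbox:
  fixes l u :: "'e::euclidean_space"
  assumes "iter_differentiable bs g" "distinct bs" "set bs = Basis" "g \<in> borel_measurable borel"
    and "\<And>h x. (\<And>b. 0 \<le> h b) \<Longrightarrow> 0 \<le> iter_diff bs h g x"
    and lu: "\<And>b. b \<in> Basis \<Longrightarrow> l \<bullet> b \<le> u \<bullet> b"
  shows "emeasure (density lborel (\<lambda>x. ennreal (iter_deriv bs g x))) (cbox l u) =
    ennreal (iter_diff bs (\<lambda>b. u \<bullet> b - l \<bullet> b) g l)"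
proof -
  have [measurable]: "iter_deriv bs g \<in> borel_measurable borel"
    using assms by (intro borel_measurable_iter_deriv)
  have ind: "indicator (cbox l u) (\<Sum>b\<in>Basis. f b *\<^sub>R b) =
      (\<Prod>b\<in>Basis. indicator {l \<bullet> b..u \<bullet> b} (f b) :: ennreal)" for f
    by (auto simp: indicator_def mem_box prod_eq_1_iff prod_zero_iff)
  have "emeasure (density lborel (\<lambda>x. ennreal (iter_deriv bs g x))) (cbox l u) =
      (\<integral>\<^sup>+x. ennreal (iter_deriv bs g x) * indicator (cbox l u) x \<partial>lborel)"
    by (simp add: emeasure_density)
  also have "\<dots> = (\<integral>\<^sup>+f. ennreal (iter_deriv bs g (0 + (\<Sum>b\<in>set bs. f b *\<^sub>R b))) *
      (\<Prod>b\<in>set bs. indicator {l \<bullet> b..u \<bullet> b} (f b)) \<partial>Pi\<^sub>M (set bs) (\<lambda>_. lborel))"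
    by (subst lborel_eq) (simp add: nn_integral_distr assms ind)
  also have "\<dots> = ennreal (iter_diff bs (\<lambda>b. u \<bullet> b - l \<bullet> b) g (0 + (\<Sum>b\<in>set bs. (l \<bullet> b) *\<^sub>R b)))"
    using assms by (intro nn_integral_iter_deriv_PiM) auto
  finally show ?thesis
    by (simp add: assms euclidean_representation)
qed

section \<open>Identifying a measure by comparison on boxes\<close>

text \<open>A point of an open box has positive distance from each of its finitely many faces. The
  exhaustion carries inequalities from closed to open boxes.\<close>

lemma box_eq_UN_cbox:
  fixes l u :: "'e::euclidean_space"
  shows "box l u = (\<Union>n. cbox (l + inverse (real (Suc n)) *\<^sub>R One) (u - inverse (real (Suc n)) *\<^sub>R One))"
    (is "_ = (\<Union>n. ?C n)")
proof (intro equalityI subsetI)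
  fix x assume x: "x \<in> box l u"
  have "\<forall>\<^sub>F n in sequentially. \<forall>b\<in>Basis.
      inverse (real (Suc n)) < x \<bullet> b - l \<bullet> b \<and> inverse (real (Suc n)) < u \<bullet> b - x \<bullet> b"
    using x by (intro eventually_ball_finite ballI eventually_conj order_tendstoD(2)[OF LIMSEQ_inverse_real_of_nat])
      (auto simp: mem_box)
  then obtain n where "\<forall>b\<in>Basis.
      inverse (real (Suc n)) < x \<bullet> b - l \<bullet> b \<and> inverse (real (Suc n)) < u \<bullet> b - x \<bullet> b"
    by (auto simp: eventually_sequentially)
  then have "x \<in> ?C n"
    by (force simp: mem_box inner_simps)
  then show "x \<in> (\<Union>n. ?C n)"
    by blast
next
  fix x assume "x \<in> (\<Union>n. ?C n)"
  then obtain n where "x \<in> ?C n"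
    by blast
  moreover have "0 < inverse (real (Suc n))"
    by simp
  ultimately obtain e where "0 < e" "x \<in> cbox (l + e *\<^sub>R One) (u - e *\<^sub>R One)"
    by blast
  then show "x \<in> box l u"
    by (force simp: mem_box inner_simps)
qed

text \<open>
  The two bounds instead of one equation allow any choice of the faces of a box on which the
  iterated difference counts mass.
\<close>

lemma eq_density_iter_deriv:
  fixes \<mu> :: "'e::euclidean_space measure"
  assumes "finite_measure \<mu>" and sets [measurable_cong]: "sets \<mu> = sets borel"
    and g: "iter_differentiable bs g" "distinct bs" "set bs = Basis" "g \<in> borel_measurable borel"
    and lower: "\<And>h x. (\<And>b. 0 \<le> h b) \<Longrightarrow>
      measure \<mu> (box x (x + (\<Sum>b\<in>Basis. h b *\<^sub>R b))) \<le> iter_diff bs h g x"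
    and upper: "\<And>h x. (\<And>b. 0 \<le> h b) \<Longrightarrow>
      iter_diff bs h g x \<le> measure \<mu> (cbox x (x + (\<Sum>b\<in>Basis. h b *\<^sub>R b)))"
  shows "\<mu> = density lborel (\<lambda>x. ennreal (iter_deriv bs g x))"
proof -
  interpret finite_measure \<mu> by fact
  define \<nu> where "\<nu> = density lborel (\<lambda>x. ennreal (iter_deriv bs g x))"
  have [measurable]: "iter_deriv bs g \<in> borel_measurable borel"
    using g by (intro borel_measurable_iter_deriv)
  have nonneg: "0 \<le> iter_diff bs h g x" if "\<And>b. 0 \<le> h b" for h x
    by (rule order_trans[OF measure_nonneg lower[OF that]])
  have cbox: "\<exists>h. (\<forall>b. 0 \<le> h b) \<and> l + (\<Sum>b\<in>Basis. h b *\<^sub>R b) = u \<and>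
      emeasure \<nu> (cbox l u) = ennreal (iter_diff bs h g l)"
    if lu: "\<forall>b\<in>Basis. l \<bullet> b \<le> u \<bullet> b" for l u
  proof (intro exI conjI allI)
    \<comment> \<open>The hypotheses want steps that are nonnegative at every vector, but the edge
      lengths are known to be so only on \<open>Basis\<close>; hence the truncation at 0.\<close>
    let ?h = "\<lambda>b. max 0 (u \<bullet> b - l \<bullet> b)"
    have "iter_diff bs ?h g = iter_diff bs (\<lambda>b. u \<bullet> b - l \<bullet> b) g"
      using lu g by (intro iter_diff_cong) (auto simp: max_def)
    then show "emeasure \<nu> (cbox l u) = ennreal (iter_diff bs ?h g l)"
      unfolding \<nu>_def using lu by (subst emeasure_density_iter_deriv_cbox[OF g nonneg]) auto
    have "(\<Sum>b\<in>Basis. ?h b *\<^sub>R b) = (\<Sum>b\<in>Basis. ((u - l) \<bullet> b) *\<^sub>R b)"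
      using lu by (intro sum.cong) (auto simp: inner_diff_left max_absorb2)
    then show "l + (\<Sum>b\<in>Basis. ?h b *\<^sub>R b) = u"
      by (simp only: euclidean_representation) simp
  qed simp
  have cbox_le: "emeasure \<nu> (cbox l u) \<le> emeasure \<mu> (cbox l u)" for l u
  proof (cases "\<forall>b\<in>Basis. l \<bullet> b \<le> u \<bullet> b")
    case True
    from cbox[OF this] show ?thesis
      using upper by (auto simp: emeasure_eq_measure intro!: ennreal_leI)
  next
    case False
    then have "cbox l u = {}"
      by (auto simp: box_eq_empty not_le)
    then show ?thesis
      by simp
  qed
  \<comment> \<open>\<open>lower\<close> compares with the mass of the closed box under
    \<open>\<nu>\<close>, whose faces are Lebesgue null and so carry no mass.\<close>
  have box_le: "emeasure \<mu> (box l u) \<le> emeasure \<nu> (box l u)" for l u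
  proof (cases "box l u = {}")
    case False
    then have "\<forall>b\<in>Basis. l \<bullet> b \<le> u \<bullet> b"
      by (force simp: box_eq_empty not_le)
    from cbox[OF this] have "emeasure \<mu> (box l u) \<le> emeasure \<nu> (cbox l u)"
      using lower by (auto simp: emeasure_eq_measure intro!: ennreal_leI)
    also have "\<dots> = emeasure \<nu> (box l u)"
    proof (rule emeasure_eq_AE)
      have "AE x in lborel. x \<notin> cbox l u - box l u"
        by (rule AE_not_in) (rule null_sets_cbox_Diff_box)
      then show "AE x in \<nu>. x \<in> cbox l u \<longleftrightarrow> x \<in> box l u"
        unfolding \<nu>_def by (subst AE_density) (use box_subset_cbox in auto)
    qed (auto simp: \<nu>_def)
    finally show ?thesis .
  qed simp
  \<comment> \<open>\<open>cbox_le\<close> on the shrunken closed boxes passes to the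
    supremum.\<close>
  have box_ge: "emeasure \<nu> (box l u) \<le> emeasure \<mu> (box l u)" for l u
  proof -
    let ?C = "\<lambda>n. cbox (l + inverse (real (Suc n)) *\<^sub>R One) (u - inverse (real (Suc n)) *\<^sub>R One)"
    have "incseq ?C"
    proof (rule monoI)
      fix m n :: nat assume "m \<le> n"
      then have "inverse (real (Suc n)) \<le> inverse (real (Suc m))"
        by (intro le_imp_inverse_le) auto
      then show "?C m \<le> ?C n"
        by (intro subset_box_imp) (auto simp: inner_simps simp del: of_nat_Suc)
    qed
    then have "emeasure \<nu> (box l u) = (SUP n. emeasure \<nu> (?C n))"
      unfolding box_eq_UN_cbox by (intro SUP_emeasure_incseq[symmetric]) (auto simp: \<nu>_def)
    also have "\<dots> \<le> emeasure \<mu> (box l u)"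
    proof (rule SUP_least)
      fix n
      have "emeasure \<nu> (?C n) \<le> emeasure \<mu> (?C n)"
        by (rule cbox_le)
      also have "\<dots> \<le> emeasure \<mu> (box l u)"
        unfolding box_eq_UN_cbox[of l u] by (intro emeasure_mono) (auto simp flip: box_eq_UN_cbox simp: sets)
      finally show "emeasure \<nu> (?C n) \<le> emeasure \<mu> (box l u)" .
    qed
    finally show ?thesis .
  qed
  have "\<mu> = \<nu>"
  proof (rule measure_eqI_generator_eq)
    let ?E = "range (\<lambda>(a, b). box a b::'e set)"
    show "Int_stable ?E"
      by (auto simp: Int_stable_def box_Int_box)
    show "?E \<subseteq> Pow UNIV" "sets \<mu> = sigma_sets UNIV ?E" "sets \<nu> = sigma_sets UNIV ?E"
      by (simp_all add: borel_eq_box sets \<nu>_def)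
    let ?A = "\<lambda>n::nat. box (- (real n *\<^sub>R One)) (real n *\<^sub>R One) :: 'e set"
    show "range ?A \<subseteq> ?E" "(\<Union>i. ?A i) = UNIV"
      unfolding UN_box_eq_UNIV by auto
    show "emeasure \<mu> (?A i) \<noteq> \<infinity>" for i
      by simp
    show "emeasure \<mu> S = emeasure \<nu> S" if "S \<in> ?E" for S
      using that box_le box_ge by (auto intro: antisym)
  qed
  then show ?thesis
    by (simp add: \<nu>_def)
qed

section \<open>Orthant probabilities and their iterated differences\<close>

lemma iter_diff_integral:
  assumes "\<And>x. integrable M (\<lambda>\<omega>. f \<omega> x)"
  shows "iter_diff bs h (\<lambda>x. \<integral>\<omega>. f \<omega> x \<partial>M) x = (\<integral>\<omega>. iter_diff bs h (f \<omega>) x \<partial>M)"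
  using assms
proof (induction bs arbitrary: f)
  case (Cons b bs)
  have "diff_step b (h b) (\<lambda>x. \<integral>\<omega>. f \<omega> x \<partial>M) = (\<lambda>x. \<integral>\<omega>. diff_step b (h b) (f \<omega>) x \<partial>M)"
    using Cons.prems by (auto simp: diff_step_def[abs_def])
  moreover have "integrable M (\<lambda>\<omega>. diff_step b (h b) (f \<omega>) x)" for x
    using Cons.prems by (auto simp: diff_step_def)
  ultimately show ?case
    using Cons.IH[of "\<lambda>\<omega>. diff_step b (h b) (f \<omega>)"] by simp
qed simp

text \<open>By orthogonality, a step along \<open>b\<close> changes only the factor at
  \<open>b\<close>. The prefix \<open>k\<close> collects the factors already differenced, which are
  constant along the remaining directions.\<close>

lemma iter_diff_prod:
  fixes bs :: "'e::euclidean_space list"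
  assumes "distinct bs" "set bs \<subseteq> Basis" "\<And>b s x. b \<in> set bs \<Longrightarrow> k (x + s *\<^sub>R b) = k x"
  shows "iter_diff bs h (\<lambda>x. k x * (\<Prod>b\<in>set bs. \<phi> b (x \<bullet> b))) x =
    k x * (\<Prod>b\<in>set bs. \<phi> b (x \<bullet> b + h b) - \<phi> b (x \<bullet> b))"
  using assms
proof (induction bs arbitrary: k)
  case (Cons b bs)
  have b: "b \<notin> set bs" "b \<bullet> b = 1" "\<And>d. d \<in> set bs \<Longrightarrow> b \<bullet> d = 0" "\<And>d. d \<in> set bs \<Longrightarrow> d \<bullet> b = 0"
    using Cons.prems by (auto simp: inner_Basis)
  have "diff_step b (h b) (\<lambda>x. k x * (\<Prod>b\<in>set (b # bs). \<phi> b (x \<bullet> b))) =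
      (\<lambda>x. (k x * (\<phi> b (x \<bullet> b + h b) - \<phi> b (x \<bullet> b))) * (\<Prod>b\<in>set bs. \<phi> b (x \<bullet> b)))"
    using b Cons.prems(3) by (auto simp: diff_step_def fun_eq_iff inner_simps algebra_simps)
  then show ?case
    using b Cons.prems
    by (simp add: inner_simps Cons.IH[of "\<lambda>x. k x * (\<phi> b (x \<bullet> b + h b) - \<phi> b (x \<bullet> b))"])
qed simp

text \<open>The sign \<open>s b\<close> orients the axis \<open>b\<close>: the event bounds the
  coordinate from above for 1 and from below for -1. Multiplying \<open>F\<close> by all signs makes
  its iterated differences nonnegative.\<close>

lemma prob_orthant_density:
  fixes X :: "'a \<Rightarrow> 'e::euclidean_space" and s :: "'e \<Rightarrow> real"
  assumes "finite_measure M" and [measurable]: "X \<in> borel_measurable M"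
    and s: "\<And>b. b \<in> Basis \<Longrightarrow> s b = 1 \<or> s b = - 1"
    and F: "\<And>x. F x = measure M {\<omega> \<in> space M. \<forall>b\<in>Basis. s b * (X \<omega> \<bullet> b) \<le> s b * (x \<bullet> b)}"
    and bs: "distinct bs" "set bs = Basis"
    and diff: "iter_differentiable bs F" and "F \<in> borel_measurable borel"
  shows "0 \<le> (\<Prod>b\<in>Basis. s b) * iter_deriv bs F x"
    and "distributed M lborel X (\<lambda>x. ennreal ((\<Prod>b\<in>Basis. s b) * iter_deriv bs F x))"
proof -
  interpret finite_measure M by fact
  define c where "c = (\<Prod>b\<in>Basis. s b)"
  \<comment> \<open>Nondecreasing in \<open>t\<close> for either sign: it jumps from 0 to 1 or from
    -1 to 0 at the coordinate of \<open>X \<omega>\<close>.\<close>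
  define \<phi> where "\<phi> \<omega> b t = s b * of_bool (s b * (X \<omega> \<bullet> b) \<le> s b * t)" for \<omega> b t
  define G where "G x = c * F x" for x
  have [measurable]: "F \<in> borel_measurable borel"
    by fact
  have G: "iter_differentiable bs G" "iter_deriv bs G = (\<lambda>x. c * iter_deriv bs F x)"
    using iter_deriv_cmult[OF diff, of c] by (simp_all add: G_def[abs_def])
  have G_meas [measurable]: "G \<in> borel_measurable borel"
    unfolding G_def[abs_def] by measurable
  have meas_\<phi> [measurable]: "(\<lambda>\<omega>. \<phi> \<omega> b t) \<in> borel_measurable M" for b t
    unfolding \<phi>_def by measurable
  have abs_\<phi>: "\<bar>\<phi> \<omega> b t\<bar> \<le> 1" if "b \<in> Basis" for \<omega> b t
    using s[OF that] by (auto simp: \<phi>_def)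
  have int_\<phi>: "integrable M (\<lambda>\<omega>. \<Prod>b\<in>set bs. \<phi> \<omega> b (x \<bullet> b))" for x
    using abs_\<phi> by (intro integrable_const_bound[where B = 1])
      (auto simp: bs abs_prod intro!: AE_I2 prod_le_1)
  have G_eq: "G = (\<lambda>x. \<integral>\<omega>. (\<Prod>b\<in>set bs. \<phi> \<omega> b (x \<bullet> b)) \<partial>M)"
  proof
    fix x
    have "(\<Prod>b\<in>set bs. \<phi> \<omega> b (x \<bullet> b)) =
        c * indicator {\<omega> \<in> space M. \<forall>b\<in>Basis. s b * (X \<omega> \<bullet> b) \<le> s b * (x \<bullet> b)} \<omega>"
      if "\<omega> \<in> space M" for \<omega>
    proof -
      have "(\<Prod>b\<in>Basis. of_bool (s b * (X \<omega> \<bullet> b) \<le> s b * (x \<bullet> b))) =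
          (of_bool (\<forall>b\<in>Basis. s b * (X \<omega> \<bullet> b) \<le> s b * (x \<bullet> b)) :: real)"
        by (cases "\<forall>b\<in>Basis. s b * (X \<omega> \<bullet> b) \<le> s b * (x \<bullet> b)") (auto simp: prod_zero_iff)
      then show ?thesis
        using that by (simp add: \<phi>_def bs prod.distrib c_def indicator_def)
    qed
    then have "(\<integral>\<omega>. (\<Prod>b\<in>set bs. \<phi> \<omega> b (x \<bullet> b)) \<partial>M) =
      (\<integral>\<omega>. c * indicator {\<omega> \<in> space M. \<forall>b\<in>Basis. s b * (X \<omega> \<bullet> b) \<le> s b * (x \<bullet> b)} \<omega> \<partial>M)"
      by (intro Bochner_Integration.integral_cong) auto
    also have "\<dots> = G x"
      by (simp add: G_def F Int_def conj_commute)
    finally show "G x = (\<integral>\<omega>. (\<Prod>b\<in>set bs. \<phi> \<omega> b (x \<bullet> b)) \<partial>M)"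
      by simp
  qed
  define \<psi> where "\<psi> h x \<omega> = (\<Prod>b\<in>Basis. \<phi> \<omega> b (x \<bullet> b + h b) - \<phi> \<omega> b (x \<bullet> b))" for h x \<omega>
  have meas_\<psi> [measurable]: "\<psi> h x \<in> borel_measurable M" for h x
    unfolding \<psi>_def[abs_def] by measurable
  have diff_G: "iter_diff bs h G x = (\<integral>\<omega>. \<psi> h x \<omega> \<partial>M)" for h x
    unfolding G_eq by (subst iter_diff_integral[OF int_\<phi>])
      (use iter_diff_prod[of bs "\<lambda>_. 1"] bs in \<open>simp add: \<psi>_def[abs_def]\<close>)
  \<comment> \<open>Each factor of \<open>\<psi>\<close> is the indicator of an interval that is
    open on the left if \<open>s b = 1\<close> and on the right if \<open>s b = - 1\<close>. Both
    lie between the open and the closed interval.\<close>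
  have \<psi>: "indicator (box x (x + (\<Sum>b\<in>Basis. h b *\<^sub>R b))) (X \<omega>) \<le> \<psi> h x \<omega>"
    "\<psi> h x \<omega> \<le> indicator (cbox x (x + (\<Sum>b\<in>Basis. h b *\<^sub>R b))) (X \<omega>)"
    if "\<And>b. 0 \<le> h b" for h x \<omega>
  proof -
    have factor: "of_bool (x \<bullet> b < X \<omega> \<bullet> b \<and> X \<omega> \<bullet> b < x \<bullet> b + h b) \<le>
        \<phi> \<omega> b (x \<bullet> b + h b) - \<phi> \<omega> b (x \<bullet> b)"
      "\<phi> \<omega> b (x \<bullet> b + h b) - \<phi> \<omega> b (x \<bullet> b) \<le>
        of_bool (x \<bullet> b \<le> X \<omega> \<bullet> b \<and> X \<omega> \<bullet> b \<le> x \<bullet> b + h b)" if "b \<in> Basis" for b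
      using s[OF that] \<open>\<And>b. 0 \<le> h b\<close>[of b] by (auto simp: \<phi>_def)
    have factor_nonneg: "0 \<le> \<phi> \<omega> b (x \<bullet> b + h b) - \<phi> \<omega> b (x \<bullet> b)" if "b \<in> Basis" for b
      by (rule order_trans[OF _ factor(1)[OF that]]) simp
    have "indicator (box x (x + (\<Sum>b\<in>Basis. h b *\<^sub>R b))) (X \<omega>) =
        (\<Prod>b\<in>Basis. of_bool (x \<bullet> b < X \<omega> \<bullet> b \<and> X \<omega> \<bullet> b < x \<bullet> b + h b) :: real)"
      by (cases "X \<omega> \<in> box x (x + (\<Sum>b\<in>Basis. h b *\<^sub>R b))")
        (auto simp: mem_box inner_add_left prod_zero_iff)
    also have "\<dots> \<le> \<psi> h x \<omega>"
      unfolding \<psi>_def using factor(1) by (intro prod_mono) auto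
    finally show "indicator (box x (x + (\<Sum>b\<in>Basis. h b *\<^sub>R b))) (X \<omega>) \<le> \<psi> h x \<omega>" .
    have "\<psi> h x \<omega> \<le> (\<Prod>b\<in>Basis. of_bool (x \<bullet> b \<le> X \<omega> \<bullet> b \<and> X \<omega> \<bullet> b \<le> x \<bullet> b + h b))"
      unfolding \<psi>_def using factor(2) factor_nonneg by (intro prod_mono conjI)
    also have "\<dots> = indicator (cbox x (x + (\<Sum>b\<in>Basis. h b *\<^sub>R b))) (X \<omega>)"
      by (cases "X \<omega> \<in> cbox x (x + (\<Sum>b\<in>Basis. h b *\<^sub>R b))")
        (auto simp: mem_box inner_add_left prod_zero_iff)
    finally show "\<psi> h x \<omega> \<le> indicator (cbox x (x + (\<Sum>b\<in>Basis. h b *\<^sub>R b))) (X \<omega>)" .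
  qed
  have int_ind: "integrable M (\<lambda>\<omega>. indicator A (X \<omega>) :: real)"
    and measure_ind: "measure (distr M borel X) A = (\<integral>\<omega>. indicator A (X \<omega>) \<partial>M)"
    if [measurable]: "A \<in> sets borel" for A
  proof -
    show "integrable M (\<lambda>\<omega>. indicator A (X \<omega>) :: real)"
      by (intro integrable_const_bound[where B = 1]) auto
    have "measure (distr M borel X) A = (\<integral>x. indicator A x \<partial>distr M borel X)"
      by simp
    also have "\<dots> = (\<integral>\<omega>. indicator A (X \<omega>) \<partial>M)"
      by (rule integral_distr) auto
    finally show "measure (distr M borel X) A = (\<integral>\<omega>. indicator A (X \<omega>) \<partial>M)" .
  qed
  have int_\<psi>: "integrable M (\<psi> h x)" if "\<And>b. 0 \<le> h b" for h x
  proof (rule integrable_const_bound[where B = 1])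
    have "0 \<le> \<psi> h x \<omega>" "\<psi> h x \<omega> \<le> 1" for \<omega>
      using \<psi>[of h x \<omega>] that by (auto simp: indicator_def split: split_of_bool_asm)
    then show "AE \<omega> in M. norm (\<psi> h x \<omega>) \<le> 1"
      by auto
  qed measurable
  have lower: "measure (distr M borel X) (box x (x + (\<Sum>b\<in>Basis. h b *\<^sub>R b))) \<le> iter_diff bs h G x"
    if "\<And>b. 0 \<le> h b" for h x
    unfolding diff_G using that by (auto simp: measure_ind int_ind int_\<psi> \<psi> intro!: integral_mono)
  have upper: "iter_diff bs h G x \<le> measure (distr M borel X) (cbox x (x + (\<Sum>b\<in>Basis. h b *\<^sub>R b)))"
    if "\<And>b. 0 \<le> h b" for h x
    unfolding diff_G using that by (auto simp: measure_ind int_ind int_\<psi> \<psi> intro!: integral_mono)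
  have nonneg: "0 \<le> iter_diff bs h G x" if "\<And>b. 0 \<le> h b" for h x
    by (rule order_trans[OF measure_nonneg lower[OF that]])
  show "0 \<le> (\<Prod>b\<in>Basis. s b) * iter_deriv bs F x"
    using iter_deriv_nonneg[OF G(1) bs(1) nonneg] by (simp add: G(2) c_def)
  have "finite_measure (distr M borel X)"
    by (intro finite_measure_distr) measurable
  then have "distr M borel X = density lborel (\<lambda>x. ennreal (iter_deriv bs G x))"
    by (rule eq_density_iter_deriv[OF _ _ G(1) bs G_meas lower upper]) simp
  moreover have "iter_deriv bs G \<in> borel_measurable borel"
    by (rule borel_measurable_iter_deriv[OF G(1) G_meas])
  moreover have "distr M lborel X = distr M borel X"
    by (rule distr_cong) auto
  ultimately show "distributed M lborel X (\<lambda>x. ennreal ((\<Prod>b\<in>Basis. s b) * iter_deriv bs F x))"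
    by (simp add: distributed_def G(2) c_def)
qed

section \<open>From Frechet differentiability to iterated directional derivatives\<close>

lemma has_real_derivative_line:
  assumes "g differentiable (at x)"
  shows "DERIV (\<lambda>t. g (x + t *\<^sub>R b)) 0 :> frechet_derivative g (at x) b"
proof -
  have g: "(g has_derivative frechet_derivative g (at x)) (at (x + 0 *\<^sub>R b))"
    using assms by (simp flip: frechet_derivative_works)
  have "((\<lambda>t. x + t *\<^sub>R b) has_derivative (\<lambda>t. t *\<^sub>R b)) (at 0)"
    by (auto intro!: derivative_eq_intros)
  from diff_chain_at[OF this g]
  have "((\<lambda>t. g (x + t *\<^sub>R b)) has_derivative (\<lambda>t. frechet_derivative g (at x) (t *\<^sub>R b))) (at 0)"
    by (simp add: o_def)
  also have "(\<lambda>t. frechet_derivative g (at x) (t *\<^sub>R b)) = (*) (frechet_derivative g (at x) b)"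
    using linear_frechet_derivative[OF assms] by (auto simp: linear_scale)
  finally show ?thesis
    by (simp add: has_field_derivative_def)
qed

text \<open>A directional derivative is the Frechet derivative at a fixed vector, which is what the
  recursion of \<open>times_differentiable\<close> speaks of. The surplus \<open>k\<close> is the
  order left after differentiating along \<open>bs\<close>; the induction spends one order of it per
  direction.\<close>

lemma iter_differentiable_if_times_differentiable:
  assumes "times_differentiable (length bs + k) g"
  shows "iter_differentiable bs g"
proof -
  have "iter_differentiable bs g \<and> times_differentiable k (iter_deriv bs g)"
    using assms
  proof (induction bs arbitrary: k)
    case (Cons b bs)
    from Cons.IH[of "Suc k"] Cons.prems
    have IH: "iter_differentiable bs g" "times_differentiable (Suc k) (iter_deriv bs g)"
      by auto
    then have D: "DERIV (\<lambda>t. iter_deriv bs g (x + t *\<^sub>R b)) 0 :>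
        frechet_derivative (iter_deriv bs g) (at x) b" for x
      by (intro has_real_derivative_line) auto
    then have "iter_deriv (b # bs) g = (\<lambda>x. frechet_derivative (iter_deriv bs g) (at x) b)"
      by (simp add: iter_deriv_Cons dir_deriv_def fun_eq_iff DERIV_imp_deriv)
    with IH D show ?case
      by auto
  qed simp
  then show ?thesis
    by auto
qed

section \<open>Hyper-rectangles in endpoint coordinates\<close>

lemma inner_axis_endpoints:
  "(x :: 'p::finite endpoints) \<bullet> axis j (1, 0) = lower x j"
  "x \<bullet> axis j (0, 1) = upper x j"
  by (simp_all add: inner_axis lower_def upper_def inner_prod_def)

lemma Basis_endpoints:
  "(Basis :: 'p::finite endpoints set) = (\<Union>j. {axis j (1, 0), axis j (0, 1)})"
  by (auto simp: Basis_vec_def Basis_prod_def)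

lemma mixed_partial_eq_iter_deriv:
  "mixed_partial js g = iter_deriv (concat (map (\<lambda>j. [axis j (1, 0), axis j (0, 1)]) js)) g"
  by (induction js)
    (simp_all add: mixed_partial_def iter_deriv_def fun_eq_iff partial_lower_def partial_upper_def
      dir_deriv_def)

text \<open>For a nonempty interval, inclusion means two endpoint inequalities. If \<open>x\<close>
  is not a hyper-rectangle, some \<open>upper x j < lower x j\<close> contradicts the order of the
  endpoints of \<open>X \<omega>\<close>, so the event is empty and the default value 0 is its
  probability.\<close>

lemma containment_cdf_eq:
  assumes "random_hyper_rectangle M X"
  shows "containment_cdf M X x =
    measure M {\<omega> \<in> space M. \<forall>j. lower x j \<le> lower (X \<omega>) j \<and> upper (X \<omega>) j \<le> upper x j}"
proof -
  have le: "lower (X \<omega>) j \<le> upper (X \<omega>) j" if "\<omega> \<in> space M" for \<omega> j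
    using assms that by (auto simp: random_hyper_rectangle_def hyper_rectangle_def)
  show ?thesis
  proof (cases "hyper_rectangle x")
    case True
    then show ?thesis
      using le by (auto simp: containment_cdf_def contained_def intro!: arg_cong[where f = "measure M"])
  next
    case False
    then obtain j where j: "upper x j < lower x j"
      by (auto simp: hyper_rectangle_def not_le)
    have "{\<omega> \<in> space M. \<forall>j. lower x j \<le> lower (X \<omega>) j \<and> upper (X \<omega>) j \<le> upper x j} = {}"
      using le[of _ j] j order_trans[of "lower x j" _ "upper x j"] by (blast dest: order_trans leD)
    then have "measure M {\<omega> \<in> space M. \<forall>j. lower x j \<le> lower (X \<omega>) j \<and> upper (X \<omega>) j \<le> upper x j} = 0"
      by (simp only: measure_empty)
    with False show ?thesis
      by (simp add: containment_cdf_def)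
  qed
qed

theorem theorem7:
  fixes M :: "'a measure"
    and X :: "'a \<Rightarrow> (real \<times> real) ^ 'p::finite"
    and js :: "'p list"
  assumes "random_hyper_rectangle M X"
    and "distinct js" and "set js = UNIV"
    and "times_differentiable (2 * CARD('p)) (containment_cdf M X)"
  shows "has_density_function M X
    (\<lambda>x. (- 1) ^ CARD('p) * mixed_partial js (containment_cdf M X) x)"
proof -
  let ?F = "containment_cdf M X"
  define bs :: "'p endpoints list" where
    "bs = concat (map (\<lambda>j. [axis j (1, 0), axis j (0, 1)]) js)"
  \<comment> \<open>Lower endpoints are bounded from below and upper endpoints from above.\<close>
  define s :: "'p endpoints \<Rightarrow> real" where
    "s b = (if b \<in> range (\<lambda>j. axis j (1, 0)) then - 1 else 1)" for b
  have M: "finite_measure M" and X: "X \<in> borel_measurable M"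
    using assms(1) by (auto simp: random_hyper_rectangle_def prob_space_def)
  have s_axis: "s (axis j (1, 0)) = - 1" "s (axis j (0, 1)) = 1" for j
    by (auto simp: s_def axis_eq_axis prod_eq_iff)
  have card: "length js = CARD('p)"
    using distinct_card[OF assms(2)] assms(3) by simp
  have set_bs: "set bs = Basis"
    using assms(3) by (auto simp: bs_def Basis_endpoints)
  have distinct_bs: "distinct bs"
    unfolding bs_def using assms(2) by (induction js) (auto simp: axis_eq_axis prod_eq_iff)
  have length_bs: "length bs = 2 * CARD('p)"
    unfolding bs_def card[symmetric] by (induction js) auto
  \<comment> \<open>Each index \<open>j\<close> contributes one -1, from its lower endpoint.\<close>
  have "prod_list (map s bs) = (- 1) ^ CARD('p)"
    unfolding bs_def card[symmetric] by (induction js) (auto simp: s_axis)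
  then have sign: "(\<Prod>b\<in>Basis. s b) = (- 1) ^ CARD('p)"
    by (simp add: prod.distinct_set_conv_list distinct_bs flip: set_bs)
  have F: "?F x = measure M {\<omega> \<in> space M. \<forall>b\<in>Basis. s b * (X \<omega> \<bullet> b) \<le> s b * (x \<bullet> b)}" for x
    unfolding containment_cdf_eq[OF assms(1)] Basis_endpoints
    by (simp add: s_axis inner_axis_endpoints)
  have diff: "iter_differentiable bs ?F"
    by (rule iter_differentiable_if_times_differentiable[where k = 0])
      (use assms(4) in \<open>simp add: length_bs\<close>)
  \<comment> \<open>The order \<open>2 * CARD('p)\<close> is positive, so at least one derivative
    exists; this gives continuity and hence measurability.\<close>
  have "?F differentiable (at x)" for x
    using assms(4) zero_less_card_finite[where 'a = 'p]
    by (cases "2 * CARD('p)") auto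
  then have "continuous_on UNIV ?F"
    by (intro continuous_at_imp_continuous_on ballI differentiable_imp_continuous_within)
  then have meas: "?F \<in> borel_measurable borel"
    by (rule borel_measurable_continuous_onI)
  have s: "s b = 1 \<or> s b = - 1" for b
    by (simp add: s_def)
  show ?thesis
    using prob_orthant_density[OF M X s F distinct_bs set_bs diff meas]
    by (simp add: has_density_function_def sign mixed_partial_eq_iter_deriv bs_def)
qed

end
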